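(* Let $\mathcal I$ be an ideal on $\mathbb N$. (1) The following conditions are equivalent: (a) $AOS(\mathcal I)\neq\emptyset$; (b) $AOS(\mathcal I^* )\neq\emptyset$; (c) $AOS(\mathcal I)$ is $\mathfrak c$-lineable; (d) $AOS(\mathcal I^* )$ is $\mathfrak c$-lineable; (e) $\mathcal I_{1/n}\cap \mathcal I^+\neq\emptyset$. (2) The following conditions are equivalent: (a) $AOS(\mathcal I^+)\neq\emptyset$; (b) $AOS(\mathcal I^+)$ is $\mathfrak c$-lineable; (c) $\mathcal I_{1/n}\cap \mathcal I^*\neq\emptyset$.
   Context: $\mathbb N=\{1,2,\dots\}$; $\mathfrak c$ is the cardinality of the continuum. An ideal on $\mathbb N$ is a nonempty family $\mathcal I\subseteq\mathcal P(\mathbb N)$ closed under subsets and finite unions, containing all finite subsets of $\mathbb N$, with $\mathbb N\notin\mathcal I$. $\mathcal I^*=\{\mathbb N\setminus A: A\in\mathcal I\}$ is the dual filter and $\mathcal I^+=\{A\subseteq\mathbb N:A\notin\mathcal I\}$ is the coideal. $\mathcal I_{1/n}=\{A\subseteq\mathbb N:\sum_{n\in A}\frac1n<\infty\}$ is the summable ideal. For a real sequence $(x_n)$: $(x_n)$ is $\mathcal I$-convergent to $0$ if $\{n:|x_n|\ge\varepsilon\}\in\mathcal I$ for every $\varepsilon>0$; it is $\mathcal I^*$-convergent (resp. $\mathcal I^+$-convergent) to $0$ if there is $F\in\mathcal I^*$ (resp. $F\in\mathcal I^+$) such that the subsequence $(x_n)_{n\in F}$ converges to $0$ in the ordinary sense.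 $\ell_1$ is the space of real sequences with absolutely convergent series. $AOS(\mathcal I)$ (resp. $AOS(\mathcal I^* )$, $AOS(\mathcal I^+)$) is the set of all $(a_n)\in\ell_1$ such that $(na_n)$ is not $\mathcal I$-convergent (resp. not $\mathcal I^*$-convergent, not $\mathcal I^+$-convergent) to zero. For a cardinal $\kappa$, a subset $Y\subseteq\ell_1$ is $\kappa$-lineable if $Y\cup\{0\}$ contains a vector subspace of dimension $\kappa$. *)

theory Defs
  imports "HOL-Analysis.Analysis" "HOL-Library.Function_Algebras"
begin

unbundle cardinal_syntax

abbreviation posnats :: "nat set" where
  "posnats \<equiv> {1..}"

definition ideal_on :: "'a set \<Rightarrow> 'a set set \<Rightarrow> bool" where
  "ideal_on X I \<longleftrightarrow>
     I \<noteq> {} \<and> I \<subseteq> Pow X \<and>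
     (\<forall>A\<in>I. \<forall>B. B \<subseteq> A \<longrightarrow> B \<in> I) \<and>
     (\<forall>A\<in>I. \<forall>B\<in>I. A \<union> B \<in> I) \<and>
     (\<forall>A. A \<subseteq> X \<and> finite A \<longrightarrow> A \<in> I) \<and>
     X \<notin> I"

definition dual_filter :: "nat set set \<Rightarrow> nat set set" where
  "dual_filter I = {posnats - A | A. A \<in> I}"

definition coideal :: "nat set set \<Rightarrow> nat set set" where
  "coideal I = {A. A \<subseteq> posnats \<and> A \<notin> I}"

definition summable_ideal :: "nat set set" where
  "summable_ideal = {A. A \<subseteq> posnats \<and> (\<lambda>n. 1 / real n) summable_on A}"

definition ideal_null :: "nat set set \<Rightarrow> (nat \<Rightarrow> real) \<Rightarrow> bool" where
  "ideal_null I x \<longleftrightarrow> (\<forall>\<epsilon>>0. {n \<in> posnats. \<bar>x n\<bar> \<ge> \<epsilon>} \<in> I)"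

text \<open>
  The following is used with the dual filter and the coideal of an ideal, all of whose
  members are infinite, so that \<^term>\<open>enumerate F\<close> lists \<^term>\<open>F\<close> increasingly.
\<close>

definition subseq_null :: "nat set set \<Rightarrow> (nat \<Rightarrow> real) \<Rightarrow> bool" where
  "subseq_null \<F> x \<longleftrightarrow> (\<exists>F\<in>\<F>. (\<lambda>k. x (enumerate F k)) \<longlonglongrightarrow> 0)"

text \<open>
  A sequence \<open>a\<^sub>1, a\<^sub>2, \<dots>\<close> is encoded as a function on all of \<^typ>\<open>nat\<close> with the
  dummy value \<open>0\<close> at index \<open>0\<close>; this makes the encoding unique and linear.
\<close>

definition ell1 :: "(nat \<Rightarrow> real) set" where
  "ell1 = {a. a 0 = 0 \<and> summable (\<lambda>n. \<bar>a n\<bar>)}"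

definition AOS :: "nat set set \<Rightarrow> (nat \<Rightarrow> real) set" where
  "AOS I = {a \<in> ell1. \<not> ideal_null I (\<lambda>n. real n * a n)}"

definition AOS_star :: "nat set set \<Rightarrow> (nat \<Rightarrow> real) set" where
  "AOS_star I = {a \<in> ell1. \<not> subseq_null (dual_filter I) (\<lambda>n. real n * a n)}"

definition AOS_plus :: "nat set set \<Rightarrow> (nat \<Rightarrow> real) set" where
  "AOS_plus I = {a \<in> ell1. \<not> subseq_null (coideal I) (\<lambda>n. real n * a n)}"

definition seq_scale :: "real \<Rightarrow> (nat \<Rightarrow> real) \<Rightarrow> nat \<Rightarrow> real" where
  "seq_scale c a = (\<lambda>n. c * a n)"

global_interpretation seq: vector_space seq_scale
  by unfold_locales (auto simp: seq_scale_def fun_eq_iff algebra_simps)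

text \<open>
  The dimension is a cardinal in the sense of the BNF cardinal library, that is, a
  well-order compared up to \<^term>\<open>ordIso\<close>.
\<close>

definition has_dimension :: "(nat \<Rightarrow> real) set \<Rightarrow> 'k rel \<Rightarrow> bool" where
  "has_dimension V \<kappa> \<longleftrightarrow> (\<exists>B. seq.independent B \<and> seq.span B = V \<and> |B| =o \<kappa>)"

definition lineable :: "'k rel \<Rightarrow> (nat \<Rightarrow> real) set \<Rightarrow> bool" where
  "lineable \<kappa> Y \<longleftrightarrow> (\<exists>V. seq.subspace V \<and> V \<subseteq> Y \<union> {0} \<and> has_dimension V \<kappa>)"

definition continuum :: "real rel" where
  "continuum = |UNIV :: real set|"

end

theory Submission
  imports Defs
begin

text \<open>
  If \<open>\<Sum> u n\<close> converges, so does \<open>\<Sum> w n * u n\<close> for some weight \<open>w\<close> tending to infinity.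

  Given \<open>a\<close> in \<open>ell1\<close>, apply this to \<open>\<bar>a n\<bar>\<close>: the set \<open>B\<close> where \<open>n * w n * \<bar>a n\<bar> \<ge> 1\<close> belongs to the
  summable ideal, and \<open>n * a n\<close> tends to \<open>0\<close> along its complement. So \<open>B\<close> witnesses the condition
  on the summable ideal whenever \<open>a\<close> fails the convergence in question.

  Conversely, let \<open>A\<close> be an infinite set in the summable ideal and apply the weight lemma to
  \<open>1 / n\<close> on \<open>A\<close>. The sequences \<open>w n powr t / n\<close> supported on \<open>A\<close>, with \<open>0 < t < 1\<close>, span a space of
  dimension continuum in \<open>ell1\<close>. For a nonzero element \<open>a\<close> of it the term of largest exponent
  dominates, so \<open>\<bar>n * a n\<bar> \<ge> 1\<close> for almost all \<open>n\<close> in \<open>A\<close>. Powers of an unbounded weight are needed: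
  if the ideal is maximal, convergence along it is a linear functional on bounded sequences, which
  has a kernel of codimension one.
\<close>

section \<open>Weights for convergent series and growth of sums of powers\<close>

lemma summable_weight_tendsto_infinity:
  fixes u :: "nat \<Rightarrow> real"
  assumes u: "summable u" and nonneg: "\<And>n. u n \<ge> 0"
  shows "\<exists>w. (\<forall>n. w n \<ge> 1) \<and> filterlim w at_top sequentially \<and> summable (\<lambda>n. w n * u n)"
proof -
  \<comment> \<open>the geometric term keeps the tails positive\<close>
  define v where "v n = u n + (1/2) ^ n" for n
  have v: "summable v" unfolding v_def by (intro summable_add u) simp
  have vpos: "v n > 0" for n
    unfolding v_def using nonneg[of n] by (intro add_nonneg_pos) auto
  define r where "r n = (\<Sum>k. v (k + n))" for n
  have rpos: "r n > 0" for n
    unfolding r_def using v vpos by (intro suminf_pos) (auto simp: summable_iff_shift)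
  have rstep: "r n = v n + r (Suc n)" for n
    using suminf_split_head[of "\<lambda>k. v (k + n)"] v by (simp add: r_def summable_iff_shift)
  have rlim: "r \<longlonglongrightarrow> 0"
    unfolding r_def by (rule suminf_exist_split2[OF v])
  have slim: "(\<lambda>n. sqrt (r n)) \<longlonglongrightarrow> 0"
    using tendsto_real_sqrt[OF rlim] by simp
  \<comment> \<open>The tails \<open>r\<close> tend to 0, which makes \<open>w\<close> unbounded;
    the summand 1 gives \<open>w n \<ge> 1\<close>. The square root is weak enough to keep the
    series convergent.\<close>
  define w where "w n = 1 + 1 / sqrt (r n)" for n
  have "filterlim (\<lambda>n. inverse (sqrt (r n))) at_top sequentially"
    using slim rpos by (intro filterlim_inverse_at_top) auto
  then have wlim: "filterlim w at_top sequentially"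
    unfolding w_def
    by (intro filterlim_tendsto_add_at_top[OF tendsto_const]) (simp add: inverse_eq_divide)
  \<comment> \<open>Since \<open>v n\<close> is the drop of \<open>r\<close>, factoring it as a
    difference of squares bounds the terms by a telescoping series.\<close>
  have bound: "u n / sqrt (r n) \<le> 2 * (sqrt (r n) - sqrt (r (Suc n)))" for n
  proof -
    let ?a = "sqrt (r n)" and ?b = "sqrt (r (Suc n))"
    have ab: "?a > 0" "?b \<ge> 0" "?b \<le> ?a"
      using rpos[of n] rpos[of "Suc n"] rstep[of n] vpos[of n] by auto
    have "u n \<le> v n" by (simp add: v_def)
    also have "\<dots> = ?a * ?a - ?b * ?b"
      using rstep[of n] rpos[of n] rpos[of "Suc n"] by simp
    also have "\<dots> = (?a - ?b) * (?a + ?b)" by (simp add: algebra_simps)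
    also have "\<dots> \<le> (?a - ?b) * (2 * ?a)"
      using ab by (intro mult_left_mono) auto
    finally show ?thesis using ab by (simp add: field_simps)
  qed
  have "summable (\<lambda>n. 2 * (sqrt (r n) - sqrt (r (Suc n))))"
    by (rule summable_mult[OF telescope_summable'[OF slim]])
  then have "summable (\<lambda>n. u n / sqrt (r n))"
  proof (rule summable_comparison_test')
    show "norm (u n / sqrt (r n)) \<le> 2 * (sqrt (r n) - sqrt (r (Suc n)))" if "n \<ge> 0" for n
      using bound[of n] nonneg[of n] rpos[of n] by simp
  qed
  then have "summable (\<lambda>n. w n * u n)"
    using summable_add[OF u, of "\<lambda>n. u n / sqrt (r n)"] by (simp add: w_def algebra_simps)
  moreover have "\<forall>n. w n \<ge> 1" using rpos by (simp add: w_def less_imp_le)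
  ultimately show ?thesis using wlim by blast
qed

text \<open>Divided by its largest power, the sum tends to the nonzero leading coefficient. All
  exponents are positive, so multiplying that power back gives unbounded growth.\<close>

lemma eventually_powr_combination_ge:
  fixes c :: "real \<Rightarrow> real"
  assumes S: "finite S" "S \<noteq> {}" "S \<subseteq> {0<..}" and c: "\<And>s. s \<in> S \<Longrightarrow> c s \<noteq> 0"
  shows "eventually (\<lambda>x. \<bar>\<Sum>s\<in>S. c s * x powr s\<bar> \<ge> K) at_top"
proof -
  let ?m = "Max S"
  have m: "?m \<in> S" "?m > 0" using S by (auto simp: Max_in subset_eq)
  have le: "s \<le> ?m" if "s \<in> S" for s using that S by simp
  have summand: "((\<lambda>x. c s * x powr (s - ?m)) \<longlongrightarrow> (if s = ?m then c ?m else 0)) at_top"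
    if "s \<in> S" for s
  proof (cases "s = ?m")
    case True
    \<comment> \<open>\<open>x powr 0\<close> is 1 except at \<open>x = 0\<close>, where it is
      0.\<close>
    have "eventually (\<lambda>x::real. x > 0) at_top" by (rule eventually_gt_at_top)
    then show ?thesis
      using True by (intro tendsto_eventually) (auto elim!: eventually_mono)
  next
    case False
    then have "((\<lambda>x::real. x powr (s - ?m)) \<longlongrightarrow> 0) at_top"
      using le[OF that] by (intro tendsto_neg_powr filterlim_ident) auto
    then show ?thesis using False tendsto_mult_right_zero by auto
  qed
  have "((\<lambda>x. \<Sum>s\<in>S. c s * x powr (s - ?m)) \<longlongrightarrow> (\<Sum>s\<in>S. if s = ?m then c ?m else 0)) at_top"
    by (intro tendsto_sum summand)
  then have "((\<lambda>x. \<bar>\<Sum>s\<in>S. c s * x powr (s - ?m)\<bar>) \<longlongrightarrow> \<bar>c ?m\<bar>) at_top"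
    using m S by (intro tendsto_rabs) (simp add: sum.delta)
  moreover have "((\<lambda>x::real. x powr - ?m) \<longlongrightarrow> 0) at_top"
    using m by (intro tendsto_neg_powr filterlim_ident) auto
  then have "filterlim (\<lambda>x::real. inverse (x powr - ?m)) at_top at_top"
    by (rule filterlim_inverse_at_top) (auto intro: eventually_mono[OF eventually_gt_at_top[of 0]])
  then have "filterlim (\<lambda>x::real. x powr ?m) at_top at_top" by (simp add: powr_minus)
  ultimately have "filterlim (\<lambda>x. \<bar>\<Sum>s\<in>S. c s * x powr (s - ?m)\<bar> * x powr ?m) at_top at_top"
    using c[OF m(1)] by (intro filterlim_tendsto_pos_mult_at_top) auto
  then have "eventually (\<lambda>x. \<bar>\<Sum>s\<in>S. c s * x powr (s - ?m)\<bar> * x powr ?m \<ge> K) at_top"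
    by (simp add: filterlim_at_top)
  with eventually_gt_at_top[of 0] show ?thesis
  proof eventually_elim
    case (elim x)
    have "(\<Sum>s\<in>S. c s * x powr (s - ?m)) * x powr ?m = (\<Sum>s\<in>S. c s * x powr s)"
      using elim(1) by (simp add: sum_distrib_right mult.assoc flip: powr_add)
    then show ?case using elim by (metis abs_mult abs_of_nonneg powr_ge_zero)
  qed
qed

section \<open>Subspaces of \<open>ell1\<close> built on sets of the summable ideal\<close>

lemma sum_fun_apply: "(\<Sum>i\<in>A. f i) x = (\<Sum>i\<in>A. f i x)"
  for f :: "'i \<Rightarrow> 'a \<Rightarrow> 'b::comm_monoid_add"
  by (induction A rule: infinite_finite_induct) auto

text \<open>For nonnegative terms unordered summability is convergence of the series, the form in
  which the weight lemma applies.\<close>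

lemma mem_summable_ideal_iff:
  "A \<in> summable_ideal \<longleftrightarrow> A \<subseteq> posnats \<and> summable (\<lambda>n. if n \<in> A then 1 / real n else 0)"
proof -
  have "(\<lambda>n. 1 / real n) summable_on A \<longleftrightarrow> (\<lambda>n. if n \<in> A then 1 / real n else 0) summable_on UNIV"
    by (rule summable_on_cong_neutral) auto
  also have "\<dots> \<longleftrightarrow> summable (\<lambda>n. if n \<in> A then 1 / real n else 0)"
    by (rule summable_on_UNIV_nonneg_real_iff) auto
  finally show ?thesis by (simp add: summable_ideal_def)
qed

lemma ell1_subspace: "seq.subspace ell1"
proof (rule seq.subspaceI)
  show "x + y \<in> ell1" if "x \<in> ell1" "y \<in> ell1" for x y
  proof -
    have "summable (\<lambda>n. \<bar>x n\<bar> + \<bar>y n\<bar>)"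
      using that by (intro summable_add) (auto simp: ell1_def)
    then have "summable (\<lambda>n. \<bar>x n + y n\<bar>)"
      by (rule summable_comparison_test'[where N = 0]) simp
    then show ?thesis using that by (simp add: ell1_def)
  qed
  show "seq_scale c x \<in> ell1" if "x \<in> ell1" for c x
    using that by (auto simp: ell1_def seq_scale_def abs_mult intro!: summable_mult)
qed (simp add: ell1_def)

text \<open>The last property mentions no ideal, so the same space serves for \<open>A\<close> in
  the coideal and for \<open>A\<close> in the dual filter.\<close>

lemma exists_continuum_dimensional_subspace:
  assumes A: "A \<in> summable_ideal" "infinite A"
  obtains V where "seq.subspace V" "V \<subseteq> ell1" "has_dimension V continuum"
    "\<And>a. a \<in> V \<Longrightarrow> a \<noteq> 0 \<Longrightarrow> finite {n \<in> A. \<bar>real n * a n\<bar> < 1}"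
proof -
  from A(1) have pos: "A \<subseteq> posnats" and sum: "summable (\<lambda>n. if n \<in> A then 1 / real n else 0)"
    by (auto simp: mem_summable_ideal_iff)
  have nonneg: "(if n \<in> A then 1 / real n else 0) \<ge> 0" for n by simp
  obtain w
    where w1: "\<And>n. w n \<ge> 1" and wlim: "filterlim w at_top sequentially"
      and wsum: "summable (\<lambda>n. w n * (if n \<in> A then 1 / real n else 0))"
    using summable_weight_tendsto_infinity[OF sum nonneg] by auto
  define f where "f t = (\<lambda>n. if n \<in> A then w n powr t / real n else 0)" for t
  \<comment> \<open>An injective image of the real line inside the unit interval, as arctan takes
    values between -2 and 2.\<close>
  define T where "T = range (\<lambda>s::real. (arctan s + 2) / 4)"
  have T: "0 < t \<and> t < 1" if "t \<in> T" for t
  proof -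
    obtain s where "t = (arctan s + 2) / 4" using \<open>t \<in> T\<close> unfolding T_def by blast
    moreover have "\<bar>arctan s\<bar> < 2" using arctan_bounded[of s] pi_less_4 by auto
    ultimately show ?thesis by auto
  qed
  have comb: "finite {n \<in> A. \<bar>real n * (\<Sum>t\<in>S. seq_scale (c t) (f t)) n\<bar> < 1}"
    if S: "finite S" "S \<noteq> {}" "S \<subseteq> T" "\<And>t. t \<in> S \<Longrightarrow> c t \<noteq> 0" for S c
  proof -
    have "eventually (\<lambda>x. \<bar>\<Sum>t\<in>S. c t * x powr t\<bar> \<ge> 1) at_top"
      using S T by (intro eventually_powr_combination_ge) auto
    then have "eventually (\<lambda>n. \<bar>\<Sum>t\<in>S. c t * w n powr t\<bar> \<ge> 1) sequentially"
      by (rule eventually_compose_filterlim[OF _ wlim])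
    then have "finite {n. \<not> \<bar>\<Sum>t\<in>S. c t * w n powr t\<bar> \<ge> 1}"
      by (simp add: eventually_cofinite flip: cofinite_eq_sequentially)
    moreover have "real n * (\<Sum>t\<in>S. seq_scale (c t) (f t)) n = (\<Sum>t\<in>S. c t * w n powr t)"
      if "n \<in> A" for n
      using that pos by (auto simp: sum_fun_apply seq_scale_def f_def sum_distrib_left intro!: sum.cong)
    ultimately show ?thesis by (elim rev_finite_subset) auto
  qed
  \<comment> \<open>For the zero sequence the exceptional set is all of \<open>A\<close>. Hence
    largeness along \<open>A\<close> also yields injectivity of \<open>f\<close> and
    independence.\<close>
  have nonzero: "a \<noteq> 0" if "finite {n \<in> A. \<bar>real n * a n\<bar> < 1}" for a
    using that A(2) by auto
  have inj: "inj_on f T"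
  proof (rule inj_onI, rule ccontr)
    fix s t assume st: "s \<in> T" "t \<in> T" "f s = f t" "s \<noteq> t"
    let ?c = "\<lambda>r. if r = s then 1 else - 1 :: real"
    have "(\<Sum>r\<in>{s, t}. seq_scale (?c r) (f r)) = 0"
      using st by (auto simp: seq_scale_def fun_eq_iff)
    moreover have "(\<Sum>r\<in>{s, t}. seq_scale (?c r) (f r)) \<noteq> 0"
      using st(1,2) by (intro nonzero comb) auto
    ultimately show False by contradiction
  qed
  have big: "finite {n \<in> A. \<bar>real n * (\<Sum>b\<in>E. seq_scale (d b) b) n\<bar> < 1}"
    if E: "finite E" "E \<subseteq> f ` T" and d: "b \<in> E" "d b \<noteq> 0" for E d b
  proof -
    \<comment> \<open>Passing to exponents allows \<open>comb\<close> to apply; zero coefficients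
      are dropped because it requires nonzero ones.\<close>
    define S where "S = {t \<in> T. f t \<in> E \<and> d (f t) \<noteq> 0}"
    have im: "f ` S = {b \<in> E. d b \<noteq> 0}" using E by (auto simp: S_def)
    have injS: "inj_on f S" using inj by (rule inj_on_subset) (auto simp: S_def)
    have "finite (f ` S)" using E im by simp
    then have "finite S" using injS by (rule finite_imageD)
    moreover have "S \<noteq> {}" using E d by (auto simp: S_def)
    ultimately have fin: "finite {n \<in> A. \<bar>real n * (\<Sum>t\<in>S. seq_scale (d (f t)) (f t)) n\<bar> < 1}"
      by (rule comb) (auto simp: S_def)
    have "(\<Sum>b\<in>E. seq_scale (d b) b) = (\<Sum>b\<in>f ` S. seq_scale (d b) b)"
      unfolding im using E by (intro sum.mono_neutral_right) auto
    also have "\<dots> = (\<Sum>t\<in>S. seq_scale (d (f t)) (f t))"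
      by (simp add: sum.reindex[OF injS])
    finally show ?thesis using fin by (simp only:)
  qed
  have indep: "seq.independent (f ` T)"
    unfolding seq.dependent_explicit using nonzero[OF big] by auto
  have "f t \<in> ell1" if t: "t \<in> T" for t
  proof -
    \<comment> \<open>As \<open>t < 1\<close> and \<open>w n \<ge> 1\<close>, the single series
      \<open>wsum\<close> dominates every \<open>f t\<close>.\<close>
    have "w n powr t \<le> w n" for n
      using powr_mono[of t 1 "w n"] T[OF t] w1[of n] by simp
    then have "\<bar>f t n\<bar> \<le> w n * (if n \<in> A then 1 / real n else 0)" for n
      using w1[of n] by (auto simp: f_def divide_right_mono)
    then have "summable (\<lambda>n. \<bar>f t n\<bar>)"
      by (intro summable_comparison_test'[OF wsum, of 0]) auto
    then show ?thesis using pos by (auto simp: ell1_def f_def)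
  qed
  then have ell1: "seq.span (f ` T) \<subseteq> ell1"
    by (intro seq.span_minimal ell1_subspace) auto
  have "inj (\<lambda>s::real. (arctan s + 2) / 4)" by (auto intro!: injI simp: arctan_eq_iff)
  then have "bij_betw (f \<circ> (\<lambda>s::real. (arctan s + 2) / 4)) UNIV (f ` T)"
    using inj unfolding T_def by (intro bij_betw_trans[of _ _ T]) (auto simp: bij_betw_def T_def)
  then have "|f ` T| =o continuum"
    unfolding continuum_def using card_of_ordIso ordIso_symmetric by blast
  then have dim: "has_dimension (seq.span (f ` T)) continuum"
    unfolding has_dimension_def using indep by blast
  have large: "finite {n \<in> A. \<bar>real n * a n\<bar> < 1}" if a: "a \<in> seq.span (f ` T)" "a \<noteq> 0" for a
  proof -
    obtain E d where E: "finite E" "E \<subseteq> f ` T" and eq: "a = (\<Sum>b\<in>E. seq_scale (d b) b)"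
      using a(1) by (auto simp: seq.span_explicit)
    obtain b where "b \<in> E" "d b \<noteq> 0"
      using a(2) unfolding eq by (metis (no_types, lifting) seq.scale_eq_0_iff sum.neutral)
    with E show ?thesis unfolding eq by (rule big)
  qed
  show ?thesis by (rule that[OF seq.subspace_span ell1 dim large])
qed

text \<open>On \<open>B\<close>, \<open>1 / n\<close> is at most the summable weighted term; off
  \<open>B\<close>, the absolute value of \<open>n * a n\<close> is below \<open>1 / w n\<close>,
  which tends to 0. The weight lets one \<open>B\<close> work for every
  \<open>\<epsilon>\<close>.\<close>

lemma ell1_null_off_summable_set:
  assumes "a \<in> ell1"
  obtains B where "B \<in> summable_ideal"
    "\<And>\<epsilon>. \<epsilon> > 0 \<Longrightarrow> finite {n \<in> posnats - B. \<bar>real n * a n\<bar> \<ge> \<epsilon>}"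
proof -
  obtain w where w1: "\<And>n. w n \<ge> 1" and wlim: "filterlim w at_top sequentially"
    and wsum: "summable (\<lambda>n. w n * \<bar>a n\<bar>)"
    using summable_weight_tendsto_infinity[of "\<lambda>n. \<bar>a n\<bar>"] assms by (auto simp: ell1_def)
  define B where "B = {n \<in> posnats. real n * (w n * \<bar>a n\<bar>) \<ge> 1}"
  have "(if n \<in> B then 1 / real n else 0) \<le> w n * \<bar>a n\<bar>" for n
    using w1[of n] by (auto simp: B_def field_simps)
  then have "summable (\<lambda>n. if n \<in> B then 1 / real n else 0)"
    by (intro summable_comparison_test'[OF wsum, of 0]) auto
  then have "B \<in> summable_ideal" by (auto simp: mem_summable_ideal_iff B_def)
  moreover have "finite {n \<in> posnats - B. \<bar>real n * a n\<bar> \<ge> \<epsilon>}" if "\<epsilon> > 0" for \<epsilon>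
  proof -
    have "eventually (\<lambda>n. w n \<ge> 1 / \<epsilon>) sequentially" using wlim by (simp add: filterlim_at_top)
    then have "finite {n. \<not> w n \<ge> 1 / \<epsilon>}"
      by (simp add: eventually_cofinite flip: cofinite_eq_sequentially)
    moreover have "\<not> w n \<ge> 1 / \<epsilon>" if n: "n \<in> posnats - B" "\<bar>real n * a n\<bar> \<ge> \<epsilon>" for n
    proof
      assume "w n \<ge> 1 / \<epsilon>"
      then have "1 / \<epsilon> * \<epsilon> \<le> w n * \<bar>real n * a n\<bar>"
        using n \<open>\<epsilon> > 0\<close> w1[of n] by (intro mult_mono) auto
      then show False using n \<open>\<epsilon> > 0\<close> by (auto simp: B_def abs_mult mult_ac)
    qed
    ultimately show ?thesis by (elim rev_finite_subset) auto
  qed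
  ultimately show ?thesis using that by blast
qed

text \<open>\<open>enumerate F\<close> is a bijection from the naturals onto \<open>F\<close>, so
  finitely many bad indices correspond to finitely many bad members.\<close>

lemma enumerate_tendsto_0_iff:
  fixes x :: "nat \<Rightarrow> real"
  assumes F: "infinite F"
  shows "(\<lambda>k. x (enumerate F k)) \<longlonglongrightarrow> 0 \<longleftrightarrow> (\<forall>\<epsilon>>0. finite {n \<in> F. \<bar>x n\<bar> \<ge> \<epsilon>})"
proof -
  have "eventually (\<lambda>k. \<bar>x (enumerate F k)\<bar> < \<epsilon>) sequentially \<longleftrightarrow> finite {n \<in> F. \<bar>x n\<bar> \<ge> \<epsilon>}" for \<epsilon>
  proof -
    have "bij_betw (enumerate F) {k. \<not> \<bar>x (enumerate F k)\<bar> < \<epsilon>} {n \<in> F. \<bar>x n\<bar> \<ge> \<epsilon>}"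
      using bij_enumerate[OF F] enumerate_in_set[OF F] by (auto simp: bij_betw_def inj_on_def not_less)
    then show ?thesis
      by (simp add: eventually_cofinite bij_betw_finite flip: cofinite_eq_sequentially)
  qed
  then show ?thesis by (simp add: tendsto_iff dist_real_def)
qed

section \<open>Convergence along an ideal, its dual filter and its coideal\<close>

context
  fixes I :: "nat set set"
  assumes I: "ideal_on posnats I"
begin

lemma ideal_subset: "A \<in> I \<Longrightarrow> B \<subseteq> A \<Longrightarrow> B \<in> I"
  and ideal_Un: "A \<in> I \<Longrightarrow> B \<in> I \<Longrightarrow> A \<union> B \<in> I"
  and ideal_finite: "A \<subseteq> posnats \<Longrightarrow> finite A \<Longrightarrow> A \<in> I"
  and posnats_notin_ideal: "posnats \<notin> I"
  and ideal_subset_posnats: "A \<in> I \<Longrightarrow> A \<subseteq> posnats"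
  using I unfolding ideal_on_def by blast+

lemma mem_dual_filter_iff: "F \<in> dual_filter I \<longleftrightarrow> F \<subseteq> posnats \<and> posnats - F \<in> I"
proof
  assume "F \<in> dual_filter I"
  then obtain A where "F = posnats - A" "A \<in> I" by (auto simp: dual_filter_def)
  then show "F \<subseteq> posnats \<and> posnats - F \<in> I"
    using ideal_subset_posnats by (auto simp: double_diff)
next
  assume "F \<subseteq> posnats \<and> posnats - F \<in> I"
  then show "F \<in> dual_filter I" unfolding dual_filter_def by (auto intro!: exI[of _ "posnats - F"])
qed

text \<open>\<open>F\<close> is covered by \<open>F \<inter> G\<close> and the complement of
  \<open>G\<close>. The latter is in \<open>I\<close>, so if the former were too, \<open>F\<close>
  would be.\<close>

lemma coideal_Int_dual_filter:
  assumes "F \<in> coideal I" "G \<in> dual_filter I"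
  shows "F \<inter> G \<in> coideal I"
proof -
  have "F \<subseteq> (F \<inter> G) \<union> (posnats - G)" using assms by (auto simp: coideal_def)
  then show ?thesis
    using assms ideal_subset ideal_Un unfolding mem_dual_filter_iff coideal_def by blast
qed

lemma dual_filter_subset_coideal: "dual_filter I \<subseteq> coideal I"
proof -
  have "posnats \<in> coideal I" using posnats_notin_ideal by (simp add: coideal_def)
  then have "posnats \<inter> F \<in> coideal I" if "F \<in> dual_filter I" for F
    using that by (rule coideal_Int_dual_filter)
  then show ?thesis by (metis inf_absorb2 mem_dual_filter_iff subsetI)
qed

lemma coideal_infinite: "F \<in> coideal I \<Longrightarrow> infinite F"
  using ideal_finite by (auto simp: coideal_def)

lemma subseq_null_iff:
  assumes "\<F> \<subseteq> coideal I"
  shows "subseq_null \<F> x \<longleftrightarrow> (\<exists>F\<in>\<F>. \<forall>\<epsilon>>0. finite {n \<in> F. \<bar>x n\<bar> \<ge> \<epsilon>})"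
  unfolding subseq_null_def
  using assms enumerate_tendsto_0_iff coideal_infinite by (metis subsetD)

text \<open>If the sequence is null along \<open>F\<close> in the dual filter, values of size at
  least \<open>\<epsilon>\<close> occur only off \<open>F\<close>, a set in \<open>I\<close>, or at
  finitely many points of \<open>F\<close>.\<close>

lemma AOS_subset_AOS_star: "AOS I \<subseteq> AOS_star I"
proof -
  have "ideal_null I x" if "subseq_null (dual_filter I) x" for x
    unfolding ideal_null_def
  proof (intro allI impI)
    fix \<epsilon> :: real assume "\<epsilon> > 0"
    with that obtain F where F: "F \<in> dual_filter I" "finite {n \<in> F. \<bar>x n\<bar> \<ge> \<epsilon>}"
      unfolding subseq_null_iff[OF dual_filter_subset_coideal] by blast
    then have "(posnats - F) \<union> {n \<in> F. \<bar>x n\<bar> \<ge> \<epsilon>} \<in> I"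
      by (intro ideal_Un[OF _ ideal_finite]) (auto simp: mem_dual_filter_iff)
    then show "{n \<in> posnats. \<bar>x n\<bar> \<ge> \<epsilon>} \<in> I" by (rule ideal_subset) auto
  qed
  then show ?thesis by (auto simp: AOS_def AOS_star_def)
qed

text \<open>If \<open>B\<close> were in \<open>I\<close>, its complement would be a dual filter set
  along which \<open>n * a n\<close> tends to 0.\<close>

lemma summable_coideal_if_AOS_star:
  assumes "a \<in> AOS_star I"
  shows "summable_ideal \<inter> coideal I \<noteq> {}"
proof -
  obtain B where B: "B \<in> summable_ideal"
    "\<And>\<epsilon>. \<epsilon> > 0 \<Longrightarrow> finite {n \<in> posnats - B. \<bar>real n * a n\<bar> \<ge> \<epsilon>}"
    using assms ell1_null_off_summable_set[of a] by (auto simp: AOS_star_def)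
  have "posnats - B \<notin> dual_filter I"
    using assms B(2) unfolding AOS_star_def subseq_null_iff[OF dual_filter_subset_coideal] by auto
  then have "B \<notin> I" by (auto simp: dual_filter_def)
  then show ?thesis using B(1) by (auto simp: coideal_def summable_ideal_def)
qed

text \<open>Here the complement of \<open>B\<close> cannot be in the coideal, so it is in
  \<open>I\<close>.\<close>

lemma summable_dual_filter_if_AOS_plus:
  assumes "a \<in> AOS_plus I"
  shows "summable_ideal \<inter> dual_filter I \<noteq> {}"
proof -
  obtain B where B: "B \<in> summable_ideal"
    "\<And>\<epsilon>. \<epsilon> > 0 \<Longrightarrow> finite {n \<in> posnats - B. \<bar>real n * a n\<bar> \<ge> \<epsilon>}"
    using assms ell1_null_off_summable_set[of a] by (auto simp: AOS_plus_def)
  have "posnats - B \<notin> coideal I"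
    using assms B(2) unfolding AOS_plus_def subseq_null_iff[OF subset_refl] by auto
  then have "B \<in> dual_filter I"
    using B(1) by (auto simp: coideal_def mem_dual_filter_iff summable_ideal_def)
  then show ?thesis using B(1) by blast
qed

text \<open>Up to a finite set, \<open>A\<close> lies where \<open>n * a n\<close> has size at least
  1, so that set cannot be in \<open>I\<close>.\<close>

lemma AOS_if_large:
  assumes a: "a \<in> ell1" and A: "A \<in> coideal I" and fin: "finite {n \<in> A. \<bar>real n * a n\<bar> < 1}"
  shows "a \<in> AOS I"
proof -
  have "{n \<in> posnats. \<bar>real n * a n\<bar> \<ge> 1} \<notin> I"
  proof
    assume "{n \<in> posnats. \<bar>real n * a n\<bar> \<ge> 1} \<in> I"
    then have "{n \<in> posnats. \<bar>real n * a n\<bar> \<ge> 1} \<union> {n \<in> A. \<bar>real n * a n\<bar> < 1} \<in> I"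
      using A fin by (intro ideal_Un[OF _ ideal_finite]) (auto simp: coideal_def)
    then have "A \<in> I"
      using A by (elim ideal_subset) (auto simp: coideal_def)
    then show False using A by (simp add: coideal_def)
  qed
  then show ?thesis using a by (auto simp: AOS_def ideal_null_def intro!: exI[of _ 1])
qed

text \<open>Every coideal set meets \<open>A\<close> in an infinite set, on which
  \<open>n * a n\<close> has size at least 1 with finitely many exceptions.\<close>

lemma AOS_plus_if_large:
  assumes a: "a \<in> ell1" and A: "A \<in> dual_filter I" and fin: "finite {n \<in> A. \<bar>real n * a n\<bar> < 1}"
  shows "a \<in> AOS_plus I"
proof -
  have "infinite {n \<in> F. \<bar>real n * a n\<bar> \<ge> 1}" if "F \<in> coideal I" for F
  proof
    assume "finite {n \<in> F. \<bar>real n * a n\<bar> \<ge> 1}"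
    with fin have "finite ({n \<in> F. \<bar>real n * a n\<bar> \<ge> 1} \<union> {n \<in> A. \<bar>real n * a n\<bar> < 1})" by simp
    then have "finite (F \<inter> A)" by (rule rev_finite_subset) auto
    then show False using coideal_infinite coideal_Int_dual_filter that A by blast
  qed
  then show ?thesis
    using a unfolding AOS_plus_def subseq_null_iff[OF subset_refl] by (auto intro!: exI[of _ 1])
qed

lemma lineable_AOS:
  assumes "summable_ideal \<inter> coideal I \<noteq> {}"
  shows "lineable continuum (AOS I)"
proof -
  from assms obtain A where A: "A \<in> summable_ideal" "A \<in> coideal I" by blast
  obtain V where "seq.subspace V" "V \<subseteq> ell1" "has_dimension V continuum"
    "\<And>a. a \<in> V \<Longrightarrow> a \<noteq> 0 \<Longrightarrow> finite {n \<in> A. \<bar>real n * a n\<bar> < 1}"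
    using exists_continuum_dimensional_subspace[OF A(1) coideal_infinite[OF A(2)]] by blast
  then show ?thesis
    unfolding lineable_def using AOS_if_large[OF _ A(2)] by blast
qed

lemma lineable_AOS_plus:
  assumes "summable_ideal \<inter> dual_filter I \<noteq> {}"
  shows "lineable continuum (AOS_plus I)"
proof -
  from assms obtain A where A: "A \<in> summable_ideal" "A \<in> dual_filter I" by blast
  then have "infinite A" using dual_filter_subset_coideal coideal_infinite by blast
  then obtain V where "seq.subspace V" "V \<subseteq> ell1" "has_dimension V continuum"
    "\<And>a. a \<in> V \<Longrightarrow> a \<noteq> 0 \<Longrightarrow> finite {n \<in> A. \<bar>real n * a n\<bar> < 1}"
    using exists_continuum_dimensional_subspace[OF A(1)] by blast
  then show ?thesis
    unfolding lineable_def using AOS_plus_if_large[OF _ A(2)] by blast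
qed

end

section \<open>From lineability to the equivalences\<close>

lemma lineable_mono: "lineable \<kappa> Y \<Longrightarrow> Y \<subseteq> Z \<Longrightarrow> lineable \<kappa> Z"
  unfolding lineable_def by blast

text \<open>A basis of cardinality continuum has a member, and independence keeps it away from the 0
  that \<open>lineable\<close> adjoins to \<open>Y\<close>.\<close>

lemma lineable_continuum_nonempty:
  assumes "lineable continuum Y"
  shows "Y \<noteq> {}"
proof -
  obtain V where V: "V \<subseteq> Y \<union> {0}" "has_dimension V continuum"
    using assms unfolding lineable_def by blast
  obtain B where B: "seq.independent B" "seq.span B = V" "|B| =o |UNIV :: real set|"
    using V(2) unfolding has_dimension_def continuum_def by blast
  have "B \<noteq> {}" using B(3) card_of_empty3 ordIso_iff_ordLeq by blast
  then obtain b where "b \<in> B" by blast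
  then have "b \<in> V" using B(2) seq.span_base by blast
  moreover have "b \<noteq> 0" using \<open>b \<in> B\<close> B(1) seq.dependent_zero by blast
  ultimately show ?thesis using V(1) by blast
qed

theorem theorem4p3:
  fixes I :: "nat set set"
  assumes "ideal_on posnats I"
  shows "(((AOS I \<noteq> {}) \<longleftrightarrow> (AOS_star I \<noteq> {})) \<and>
          ((AOS I \<noteq> {}) \<longleftrightarrow> lineable continuum (AOS I)) \<and>
          ((AOS I \<noteq> {}) \<longleftrightarrow> lineable continuum (AOS_star I)) \<and>
          ((AOS I \<noteq> {}) \<longleftrightarrow> summable_ideal \<inter> coideal I \<noteq> {})) \<and>
         (((AOS_plus I \<noteq> {}) \<longleftrightarrow> lineable continuum (AOS_plus I)) \<and>
          ((AOS_plus I \<noteq> {}) \<longleftrightarrow> summable_ideal \<inter> dual_filter I \<noteq> {}))"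
proof -
  \<comment> \<open>For (1) the implications run (a), (b), (e), (c), (d); nonemptiness of lineable
    sets leads from (c) to (a) and from (d) to (b).\<close>
  have "AOS I \<noteq> {} \<Longrightarrow> AOS_star I \<noteq> {}"
    using AOS_subset_AOS_star[OF assms] by blast
  moreover have "AOS_star I \<noteq> {} \<Longrightarrow> summable_ideal \<inter> coideal I \<noteq> {}"
    using summable_coideal_if_AOS_star[OF assms] by blast
  moreover have "summable_ideal \<inter> coideal I \<noteq> {} \<Longrightarrow> lineable continuum (AOS I)"
    by (rule lineable_AOS[OF assms])
  moreover have "lineable continuum (AOS I) \<Longrightarrow> lineable continuum (AOS_star I)"
    using lineable_mono AOS_subset_AOS_star[OF assms] by blast
  moreover have "AOS_plus I \<noteq> {} \<Longrightarrow> summable_ideal \<inter> dual_filter I \<noteq> {}"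
    using summable_dual_filter_if_AOS_plus[OF assms] by blast
  moreover have "summable_ideal \<inter> dual_filter I \<noteq> {} \<Longrightarrow> lineable continuum (AOS_plus I)"
    by (rule lineable_AOS_plus[OF assms])
  ultimately show ?thesis using lineable_continuum_nonempty by metis
qed

end
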